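(* Let $E_1,E_2$ be real Banach spaces, let $C\subset E_1$ and $Q\subset E_2$ be nonempty, closed and convex, let $A:E_1\to E_2$ be a bounded linear operator, and let $f:E_1\times E_1\to\mathbb{R}$ and $g:E_2\times E_2\to\mathbb{R}$ be bifunctions. Let $N$ be a normed space, let $M\subset N$ be a closed ball centered at $p^*$ with positive radius, and let $\tilde f:M\times E_1\times E_1\to\mathbb{R}$ and $\tilde g:M\times E_2\times E_2\to\mathbb{R}$ be functions with $\tilde f(p^*,\cdot,\cdot)=f$ and $\tilde g(p^*,\cdot,\cdot)=g$, such that $\tilde f(\cdot,\cdot,x)$ and $\tilde g(\cdot,\cdot,y)$ are upper semi-continuous for each $(x,y)\in E_1\times E_2$. Then the split equilibrium problem $SEP(f,g,C,Q)$ is LP well-posed by perturbations if and only if $$S(\epsilon)\neq\emptyset\quad\forall\,\epsilon>0\qquad\text{and}\qquad \operatorname{diam}(S(\epsilon))\to 0\ \text{ as }\ \epsilon\to 0.$$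
   Context: The split equilibrium problem $SEP(f,g,C,Q)$ is: find $(x^*,y^* )\in E_1\times E_2$ such that $x^*\in C$, $y^*\in Q$, $y^*=Ax^*$, $f(x^*,x)\ge 0$ for all $x\in C$, and $g(y^*,y)\ge 0$ for all $y\in Q$. Its solution set is denoted by $S$. The space $E_1\times E_2$ carries a standard product norm (e.g. $\|(x,y)\|=\|x\|+\|y\|$). Upper semi-continuity: a real function $h$ of two variables is upper semi-continuous at $(u,v)$ if $\limsup_{n\to\infty}h(u_n,v_n)\le h(u,v)$ for every sequence $(u_n,v_n)\to(u,v)$ in its domain; it is upper semi-continuous if this holds at every point of its domain (jointly in both variables). Generalized approximating sequence: let $\{p_n\}\subset M$ with $p_n\to p^*$. A sequence $\{(x_n,y_n)\}$ in $E_1\times E_2$ is a generalized approximating sequence corresponding to $\{p_n\}$ for $SEP(f,g,C,Q)$ if there exists a sequence of positive numbers $\epsilon_n\to 0$ such that, for every $n$, $d(x_n,C)\le\epsilon_n$, $d(y_n,Q)\le\epsilon_n$, $\|y_n-Ax_n\|\le\epsilon_n$, $\tilde f(p_n,x_n,x)\ge-\epsilon_n$ for all $x\in C$, and $\tilde g(p_n,y_n,y)\ge-\epsilon_n$ for all $y\in Q$. Here $d(a,B)=\inf_{b\in B}\|a-b\|$. LP (Levitin-Polyak) well-posedness by perturbations: $SEP(f,g,C,Q)$ is LP well-posed by perturbations if $S$ is a singleton and, for any $\{p_n\}\subset M$ with $p_n\to p^*$, every generalized approximating sequence corresponding to $\{p_n\}$ converges to the unique solution. Approximate solution set: for $\epsilon\ge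 0$, $S(\epsilon)$ is the set of all $(z,w)\in E_1\times E_2$ for which there is $p\in M$ with $\|p-p^*\|\le\epsilon$ such that $d(z,C)\le\epsilon$, $d(w,Q)\le\epsilon$, $\|w-Az\|\le\epsilon$, $\tilde f(p,z,x)\ge-\epsilon$ for all $x\in C$, and $\tilde g(p,w,y)\ge-\epsilon$ for all $y\in Q$. The diameter of a set $B$ is $\operatorname{diam}(B)=\sup\{\|u-v\|:u,v\in B\}$. *)

theory Defs
  imports "HOL-Analysis.Analysis"
begin

(* The limsup is taken in the extended reals, since it may be infinite for a real-valued h. *)
definition usc_on :: "'a::topological_space set \<Rightarrow> ('a \<Rightarrow> real) \<Rightarrow> bool" where
  "usc_on D h \<longleftrightarrow>
     (\<forall>z\<in>D. \<forall>s::nat \<Rightarrow> 'a. (\<forall>n. s n \<in> D) \<longrightarrow> s \<longlonglongrightarrow> z \<longrightarrow>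
        limsup (\<lambda>n. ereal (h (s n))) \<le> ereal (h z))"

(* Unlike the real-valued diameter of the library, whose value is unspecified
   on unbounded sets, this is infinite there. *)
definition ediam :: "'a::real_normed_vector set \<Rightarrow> ennreal" where
  "ediam B = (SUP (u, v)\<in>B \<times> B. ennreal (norm (u - v)))"

definition sep_solutions ::
  "('a \<Rightarrow> 'a \<Rightarrow> real) \<Rightarrow> ('b \<Rightarrow> 'b \<Rightarrow> real) \<Rightarrow> 'a set \<Rightarrow> 'b set \<Rightarrow> ('a \<Rightarrow> 'b) \<Rightarrow> ('a \<times> 'b) set" where
  "sep_solutions f g C Q A =
     {(z, w). z \<in> C \<and> w \<in> Q \<and> w = A z \<and> (\<forall>x\<in>C. f z x \<ge> 0) \<and> (\<forall>y\<in>Q. g w y \<ge> 0)}"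

(* In the following, ft p and gt p are the perturbed bifunctions; they are
   total in p but only evaluated at parameters p in M. *)

definition gen_approx_seq ::
  "('n \<Rightarrow> 'a \<Rightarrow> 'a \<Rightarrow> real) \<Rightarrow> ('n \<Rightarrow> 'b \<Rightarrow> 'b \<Rightarrow> real) \<Rightarrow> 'a::real_normed_vector set \<Rightarrow>
   'b::real_normed_vector set \<Rightarrow> ('a \<Rightarrow> 'b) \<Rightarrow> (nat \<Rightarrow> 'n) \<Rightarrow> (nat \<Rightarrow> 'a) \<Rightarrow> (nat \<Rightarrow> 'b) \<Rightarrow> bool" where
  "gen_approx_seq ft gt C Q A p x y \<longleftrightarrow>
     (\<exists>\<epsilon>::nat \<Rightarrow> real. (\<forall>n. \<epsilon> n > 0) \<and> \<epsilon> \<longlonglongrightarrow> 0 \<and>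
        (\<forall>n. infdist (x n) C \<le> \<epsilon> n \<and> infdist (y n) Q \<le> \<epsilon> n \<and>
             norm (y n - A (x n)) \<le> \<epsilon> n \<and>
             (\<forall>u\<in>C. ft (p n) (x n) u \<ge> - \<epsilon> n) \<and>
             (\<forall>v\<in>Q. gt (p n) (y n) v \<ge> - \<epsilon> n)))"

definition lp_well_posed ::
  "('a \<Rightarrow> 'a \<Rightarrow> real) \<Rightarrow> ('b \<Rightarrow> 'b \<Rightarrow> real) \<Rightarrow>
   ('n \<Rightarrow> 'a \<Rightarrow> 'a \<Rightarrow> real) \<Rightarrow> ('n \<Rightarrow> 'b \<Rightarrow> 'b \<Rightarrow> real) \<Rightarrow> 'a::real_normed_vector set \<Rightarrow>
   'b::real_normed_vector set \<Rightarrow> ('a \<Rightarrow> 'b) \<Rightarrow> 'n::real_normed_vector set \<Rightarrow> 'n \<Rightarrow> bool" where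
  "lp_well_posed f g ft gt C Q A M pstar \<longleftrightarrow>
     (\<exists>z. sep_solutions f g C Q A = {z} \<and>
        (\<forall>p x y. (\<forall>n. p n \<in> M) \<longrightarrow> p \<longlonglongrightarrow> pstar \<longrightarrow> gen_approx_seq ft gt C Q A p x y \<longrightarrow>
           (\<lambda>n. (x n, y n)) \<longlonglongrightarrow> z))"

definition approx_solutions ::
  "('n \<Rightarrow> 'a \<Rightarrow> 'a \<Rightarrow> real) \<Rightarrow> ('n \<Rightarrow> 'b \<Rightarrow> 'b \<Rightarrow> real) \<Rightarrow> 'a::real_normed_vector set \<Rightarrow>
   'b::real_normed_vector set \<Rightarrow> ('a \<Rightarrow> 'b) \<Rightarrow> 'n::real_normed_vector set \<Rightarrow> 'n \<Rightarrow> real \<Rightarrow>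
   ('a \<times> 'b) set" where
  "approx_solutions ft gt C Q A M pstar \<epsilon> =
     {(z, w). \<exists>p\<in>M. norm (p - pstar) \<le> \<epsilon> \<and>
        infdist z C \<le> \<epsilon> \<and> infdist w Q \<le> \<epsilon> \<and> norm (w - A z) \<le> \<epsilon> \<and>
        (\<forall>x\<in>C. ft p z x \<ge> - \<epsilon>) \<and> (\<forall>y\<in>Q. gt p w y \<ge> - \<epsilon>)}"

end

theory Submission
  imports Defs
begin

text \<open>
  Up to the choice of parameters, generalized approximating sequences are the sequences
  whose terms lie in approximate solution sets with tolerance tending to zero, and by
  upper semi-continuity every limit of such a sequence is a solution. If the problem is
  well-posed, points of the approximate solution sets staying away from the unique
  solution would form a generalized approximating sequence that fails to converge to it.
  Conversely, if the diameters shrink to zero, any selection of approximate solutions is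
  Cauchy, so completeness provides a solution; as that solution lies in all the
  approximate solution sets, it attracts every generalized approximating sequence.
\<close>

section \<open>Diameters of nested families of sets\<close>

lemma norm_diff_le_ediam:
  "u \<in> B \<Longrightarrow> v \<in> B \<Longrightarrow> ennreal (norm (u - v)) \<le> ediam B"
  unfolding ediam_def by (rule SUP_upper2[where i = "(u, v)"]) auto

lemma ediam_le:
  assumes "\<And>u v. u \<in> B \<Longrightarrow> v \<in> B \<Longrightarrow> norm (u - v) \<le> d"
  shows "ediam B \<le> ennreal d"
  unfolding ediam_def by (rule SUP_least) (auto intro!: ennreal_leI assms)

text \<open>Since the sets shrink with the tolerance, a bound at one tolerance persists at all
  smaller ones. This trades the limit in \<open>ennreal\<close> for plain norm estimates.\<close>

lemma ediam_tendsto_0_iff: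
  fixes S :: "real \<Rightarrow> 'a::real_normed_vector set"
  assumes mono: "\<And>\<delta> \<epsilon>. \<delta> \<le> \<epsilon> \<Longrightarrow> S \<delta> \<subseteq> S \<epsilon>"
  shows "((\<lambda>\<epsilon>. ediam (S \<epsilon>)) \<longlongrightarrow> 0) (at_right 0) \<longleftrightarrow>
    (\<forall>d>0. \<exists>\<epsilon>>0. \<forall>u\<in>S \<epsilon>. \<forall>v\<in>S \<epsilon>. norm (u - v) \<le> d)"
proof
  assume lim: "((\<lambda>\<epsilon>. ediam (S \<epsilon>)) \<longlongrightarrow> 0) (at_right 0)"
  show "\<forall>d>0. \<exists>\<epsilon>>0. \<forall>u\<in>S \<epsilon>. \<forall>v\<in>S \<epsilon>. norm (u - v) \<le> d"
  proof (intro allI impI)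
    fix d :: real assume "d > 0"
    then have "\<forall>\<^sub>F \<epsilon> in at_right 0. ediam (S \<epsilon>) < ennreal d"
      using lim by (auto intro: order_tendstoD)
    then obtain b :: real where "b > 0" and b: "\<And>\<epsilon>. 0 < \<epsilon> \<Longrightarrow> \<epsilon> < b \<Longrightarrow> ediam (S \<epsilon>) < ennreal d"
      unfolding eventually_at_right_field by auto
    \<comment> \<open>The bound is known only strictly between 0 and \<open>b\<close>, so
      \<open>b/2\<close> serves as the tolerance.\<close>
    have "norm (u - v) \<le> d" if "u \<in> S (b/2)" "v \<in> S (b/2)" for u v
    proof -
      have "ennreal (norm (u - v)) \<le> ennreal d"
        using norm_diff_le_ediam[OF that] b[of "b/2"] \<open>b > 0\<close>
        by (auto intro: order_trans less_imp_le)
      then show ?thesis using \<open>d > 0\<close> by (simp add: ennreal_le_iff)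
    qed
    then show "\<exists>\<epsilon>>0. \<forall>u\<in>S \<epsilon>. \<forall>v\<in>S \<epsilon>. norm (u - v) \<le> d"
      using \<open>b > 0\<close> by (intro exI[of _ "b/2"]) auto
  qed
next
  assume small: "\<forall>d>0. \<exists>\<epsilon>>0. \<forall>u\<in>S \<epsilon>. \<forall>v\<in>S \<epsilon>. norm (u - v) \<le> d"
  show "((\<lambda>\<epsilon>. ediam (S \<epsilon>)) \<longlongrightarrow> 0) (at_right 0)"
  proof (rule order_tendstoI)
    fix c :: ennreal assume "0 < c"
    \<comment> \<open>As \<open>c\<close> may be infinite, density of the order supplies a positive
      finite \<open>d\<close> below it.\<close>
    then obtain d :: real where "d > 0" "ennreal d < c"
      using dense[of 0 c] by (metis ennreal_cases ennreal_less_zero_iff top.not_eq_extremum less_top order_less_trans)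
    with small obtain b where "b > 0" and b: "\<forall>u\<in>S b. \<forall>v\<in>S b. norm (u - v) \<le> d"
      by blast
    have "ediam (S \<epsilon>) < c" if "\<epsilon> < b" for \<epsilon>
    proof -
      have "ediam (S \<epsilon>) \<le> ennreal d"
        using b mono[of \<epsilon> b] that by (intro ediam_le) auto
      then show ?thesis using \<open>ennreal d < c\<close> by (rule le_less_trans)
    qed
    then show "\<forall>\<^sub>F \<epsilon> in at_right 0. ediam (S \<epsilon>) < c"
      using \<open>b > 0\<close> unfolding eventually_at_right_field by auto
  qed simp
qed

section \<open>Passage to the limit\<close>

text \<open>The lower bounds \<open>- \<epsilon> n\<close> converge to 0, so the limsup of the
  values along \<open>s\<close> is at least 0, while upper semi-continuity keeps it below
  \<open>h z\<close>.\<close>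

lemma usc_on_limit_nonneg:
  assumes "usc_on D h" "z \<in> D" "\<And>n. s n \<in> D" "s \<longlonglongrightarrow> z"
    and "\<epsilon> \<longlonglongrightarrow> 0" "\<And>n. - \<epsilon> n \<le> h (s n)"
  shows "0 \<le> h z"
proof -
  have "(\<lambda>n. ereal (- \<epsilon> n)) \<longlonglongrightarrow> ereal (- 0)"
    using assms(5) by (intro tendsto_intros)
  then have "ereal 0 = limsup (\<lambda>n. ereal (- \<epsilon> n))"
    by (simp flip: zero_ereal_def add: lim_imp_Limsup)
  also have "\<dots> \<le> limsup (\<lambda>n. ereal (h (s n)))"
    using assms(6) by (intro Limsup_mono) simp
  also have "\<dots> \<le> ereal (h z)"
    using assms(1-4) unfolding usc_on_def by blast
  finally show ?thesis by simp
qed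

text \<open>The distance to \<open>C\<close> is continuous, hence vanishes at the limit.
  Nonemptiness matters because \<open>infdist\<close> to the empty set is 0 by convention.\<close>

lemma infdist_limit_mem:
  assumes "closed C" "C \<noteq> {}" "x \<longlonglongrightarrow> a" "\<epsilon> \<longlonglongrightarrow> 0" "\<And>n. infdist (x n) C \<le> \<epsilon> n"
  shows "a \<in> C"
proof -
  have "infdist a C \<le> 0"
    using assms(3-5) by (intro LIMSEQ_le[OF tendsto_infdist]) auto
  then show ?thesis
    using assms(1,2) infdist_nonneg[of a C] by (simp add: in_closed_iff_infdist_zero)
qed

section \<open>Approximate solution sets and generalized approximating sequences\<close>

lemma approx_solutions_mono:
  assumes "\<delta> \<le> \<epsilon>"
  shows "approx_solutions ft gt C Q A M pstar \<delta> \<subseteq> approx_solutions ft gt C Q A M pstar \<epsilon>"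
proof
  fix zw assume "zw \<in> approx_solutions ft gt C Q A M pstar \<delta>"
  then obtain z w p where "zw = (z, w)" "p \<in> M" and p: "norm (p - pstar) \<le> \<delta>"
    "infdist z C \<le> \<delta>" "infdist w Q \<le> \<delta>" "norm (w - A z) \<le> \<delta>"
    "\<forall>x\<in>C. - \<delta> \<le> ft p z x" "\<forall>y\<in>Q. - \<delta> \<le> gt p w y"
    unfolding approx_solutions_def by auto
  moreover have "- \<epsilon> \<le> - \<delta>" using assms by simp
  ultimately show "zw \<in> approx_solutions ft gt C Q A M pstar \<epsilon>"
    unfolding approx_solutions_def using assms by (blast intro: order_trans)
qed

text \<open>The unperturbed parameter \<open>pstar\<close> is an admissible witness, at distance 0
  from itself.\<close>

lemma sep_solutions_subset_approx_solutions:
  assumes "pstar \<in> M" "0 \<le> \<epsilon>"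
  shows "sep_solutions (ft pstar) (gt pstar) C Q A \<subseteq> approx_solutions ft gt C Q A M pstar \<epsilon>"
  unfolding sep_solutions_def approx_solutions_def
  using assms by (force intro: bexI[of _ pstar])

text \<open>Each membership hides a parameter within \<open>\<epsilon> n\<close> of
  \<open>pstar\<close>; choosing one for every \<open>n\<close> gives a sequence that is forced to
  converge to \<open>pstar\<close>.\<close>

lemma approx_solutions_sequence:
  assumes "\<And>n. s n \<in> approx_solutions ft gt C Q A M pstar (\<epsilon> n)"
    and "\<And>n. 0 < \<epsilon> n" "\<epsilon> \<longlonglongrightarrow> 0"
  obtains p where "\<And>n. p n \<in> M" "p \<longlonglongrightarrow> pstar"
    "gen_approx_seq ft gt C Q A p (\<lambda>n. fst (s n)) (\<lambda>n. snd (s n))"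
proof -
  have "\<forall>n. \<exists>p\<in>M. norm (p - pstar) \<le> \<epsilon> n \<and> infdist (fst (s n)) C \<le> \<epsilon> n \<and>
      infdist (snd (s n)) Q \<le> \<epsilon> n \<and> norm (snd (s n) - A (fst (s n))) \<le> \<epsilon> n \<and>
      (\<forall>x\<in>C. ft p (fst (s n)) x \<ge> - \<epsilon> n) \<and> (\<forall>y\<in>Q. gt p (snd (s n)) y \<ge> - \<epsilon> n)"
    using assms(1) unfolding approx_solutions_def by (auto simp: case_prod_beta)
  then obtain p where p: "\<And>n. p n \<in> M" "\<And>n. norm (p n - pstar) \<le> \<epsilon> n"
      "\<And>n. infdist (fst (s n)) C \<le> \<epsilon> n \<and> infdist (snd (s n)) Q \<le> \<epsilon> n \<and>
        norm (snd (s n) - A (fst (s n))) \<le> \<epsilon> n \<and>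
        (\<forall>x\<in>C. ft (p n) (fst (s n)) x \<ge> - \<epsilon> n) \<and> (\<forall>y\<in>Q. gt (p n) (snd (s n)) y \<ge> - \<epsilon> n)"
    by metis
  have "(\<lambda>n. p n - pstar) \<longlonglongrightarrow> 0"
    by (rule Lim_null_comparison[OF _ assms(3)]) (simp add: p(2))
  then have "p \<longlonglongrightarrow> pstar"
    by (simp add: LIM_zero_iff)
  moreover have "gen_approx_seq ft gt C Q A p (\<lambda>n. fst (s n)) (\<lambda>n. snd (s n))"
    unfolding gen_approx_seq_def using assms(2,3) p(3) by blast
  ultimately show ?thesis using that p(1) by blast
qed

text \<open>The tolerance of an approximate solution set also bounds the distance of the parameter
  from \<open>pstar\<close>, which the errors of the sequence do not control. Adding that distance
  to the error repairs this and still tends to 0.\<close>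

lemma gen_approx_seq_in_approx_solutions:
  assumes "gen_approx_seq ft gt C Q A p x y" "\<And>n. p n \<in> M" "p \<longlonglongrightarrow> pstar"
  obtains \<delta> where "\<delta> \<longlonglongrightarrow> 0" "\<And>n. (x n, y n) \<in> approx_solutions ft gt C Q A M pstar (\<delta> n)"
proof -
  obtain \<epsilon> where "\<And>n. \<epsilon> n > 0" and \<epsilon>0: "\<epsilon> \<longlonglongrightarrow> 0"
    and \<epsilon>: "\<And>n. infdist (x n) C \<le> \<epsilon> n" "\<And>n. infdist (y n) Q \<le> \<epsilon> n"
      "\<And>n. norm (y n - A (x n)) \<le> \<epsilon> n" "\<And>n u. u \<in> C \<Longrightarrow> - \<epsilon> n \<le> ft (p n) (x n) u"
      "\<And>n v. v \<in> Q \<Longrightarrow> - \<epsilon> n \<le> gt (p n) (y n) v"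
    using assms(1) unfolding gen_approx_seq_def by blast
  define \<delta> where "\<delta> n = \<epsilon> n + norm (p n - pstar)" for n
  have le: "\<epsilon> n \<le> \<delta> n" "- \<delta> n \<le> - \<epsilon> n" "norm (p n - pstar) \<le> \<delta> n" for n
    using \<open>\<epsilon> n > 0\<close> by (auto simp: \<delta>_def)
  have "\<delta> \<longlonglongrightarrow> 0 + norm (pstar - pstar)"
    unfolding \<delta>_def by (intro tendsto_intros \<epsilon>0 assms(3))
  then have "\<delta> \<longlonglongrightarrow> 0" by simp
  moreover have "(x n, y n) \<in> approx_solutions ft gt C Q A M pstar (\<delta> n)" for n
    unfolding approx_solutions_def
    using assms(2)[of n] le[of n] \<epsilon>(1-3)[of n] \<epsilon>(4,5)[where n = n]
    by (auto intro!: bexI[of _ "p n"] intro: order_trans[OF le(2)] order_trans[OF _ le(1)])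
  ultimately show ?thesis using that by blast
qed

text \<open>Membership in \<open>C\<close> and \<open>Q\<close> survives by closedness, the linear
  constraint by continuity of \<open>A\<close>, and the inequalities by upper semi-continuity
  jointly in parameter and point, with the test point fixed.\<close>

lemma gen_approx_seq_limit_mem_sep_solutions:
  fixes C :: "'a::real_normed_vector set" and Q :: "'b::real_normed_vector set"
    and M :: "'n::real_normed_vector set"
  assumes seq: "gen_approx_seq ft gt C Q A p x y"
    and p: "\<And>n. p n \<in> M" "p \<longlonglongrightarrow> pstar" "pstar \<in> M"
    and lim: "x \<longlonglongrightarrow> a" "y \<longlonglongrightarrow> b"
    and C: "closed C" "C \<noteq> {}" and Q: "closed Q" "Q \<noteq> {}" and A: "bounded_linear A"
    and usc: "\<And>x. usc_on (M \<times> UNIV) (\<lambda>(p, z). ft p z x)"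
      "\<And>y. usc_on (M \<times> UNIV) (\<lambda>(p, w). gt p w y)"
  shows "(a, b) \<in> sep_solutions (ft pstar) (gt pstar) C Q A"
proof -
  obtain \<epsilon> where \<epsilon>0: "\<epsilon> \<longlonglongrightarrow> 0"
    and \<epsilon>: "\<And>n. infdist (x n) C \<le> \<epsilon> n" "\<And>n. infdist (y n) Q \<le> \<epsilon> n"
      "\<And>n. norm (y n - A (x n)) \<le> \<epsilon> n" "\<And>n u. u \<in> C \<Longrightarrow> - \<epsilon> n \<le> ft (p n) (x n) u"
      "\<And>n v. v \<in> Q \<Longrightarrow> - \<epsilon> n \<le> gt (p n) (y n) v"
    using seq unfolding gen_approx_seq_def by blast
  have "a \<in> C" "b \<in> Q"
    using infdist_limit_mem C Q lim \<epsilon>0 \<epsilon>(1,2) by blast+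
  moreover have "b = A a"
  proof -
    have "(\<lambda>n. y n - A (x n)) \<longlonglongrightarrow> b - A a"
      by (intro tendsto_diff lim bounded_linear.tendsto[OF A])
    moreover have "(\<lambda>n. y n - A (x n)) \<longlonglongrightarrow> 0"
      by (rule Lim_null_comparison[OF _ \<epsilon>0]) (simp add: \<epsilon>(3))
    ultimately show ?thesis using LIMSEQ_unique by fastforce
  qed
  moreover have "0 \<le> ft pstar a u" if "u \<in> C" for u
    using usc_on_limit_nonneg[OF usc(1)[of u], of "(pstar, a)" "\<lambda>n. (p n, x n)" \<epsilon>]
      p lim \<epsilon>0 \<epsilon>(4)[OF that] by (auto intro: tendsto_Pair)
  moreover have "0 \<le> gt pstar b v" if "v \<in> Q" for v
    using usc_on_limit_nonneg[OF usc(2)[of v], of "(pstar, b)" "\<lambda>n. (p n, y n)" \<epsilon>]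
      p lim \<epsilon>0 \<epsilon>(5)[OF that] by (auto intro: tendsto_Pair)
  ultimately show ?thesis
    unfolding sep_solutions_def by blast
qed

section \<open>Well-posedness and shrinking approximate solution sets\<close>

text \<open>Well-posedness speaks of sequences only; the uniform statement follows by picking, for
  each tolerance \<open>1/(n+1)\<close>, a point outside the ball.\<close>

lemma lp_well_posed_approx_solutions_near:
  assumes wp: "lp_well_posed f g ft gt C Q A M pstar"
    and z: "z \<in> sep_solutions f g C Q A" and "0 < d"
  shows "\<exists>\<epsilon>>0. approx_solutions ft gt C Q A M pstar \<epsilon> \<subseteq> ball z d"
proof (rule ccontr)
  let ?S = "approx_solutions ft gt C Q A M pstar"
  let ?e = "\<lambda>n. inverse (real (Suc n))"
  assume "\<not> (\<exists>\<epsilon>>0. ?S \<epsilon> \<subseteq> ball z d)"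
  then have "\<exists>u. u \<in> ?S (?e n) \<and> u \<notin> ball z d" for n
    by (auto simp: subset_iff)
  then obtain s where s: "\<And>n. s n \<in> ?S (?e n)" "\<And>n. s n \<notin> ball z d"
    by metis
  obtain p where "\<And>n. p n \<in> M" "p \<longlonglongrightarrow> pstar"
    "gen_approx_seq ft gt C Q A p (\<lambda>n. fst (s n)) (\<lambda>n. snd (s n))"
    using approx_solutions_sequence[OF s(1) _ LIMSEQ_inverse_real_of_nat] by auto
  moreover obtain z' where "sep_solutions f g C Q A = {z'}"
    and "\<forall>p x y. (\<forall>n. p n \<in> M) \<longrightarrow> p \<longlonglongrightarrow> pstar \<longrightarrow>
      gen_approx_seq ft gt C Q A p x y \<longrightarrow> (\<lambda>n. (x n, y n)) \<longlonglongrightarrow> z'"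
    using wp unfolding lp_well_posed_def by (elim exE conjE)
  moreover from this(1) z have "z' = z" by simp
  ultimately have "(\<lambda>n. (fst (s n), snd (s n))) \<longlonglongrightarrow> z"
    by metis
  then have "s \<longlonglongrightarrow> z" by simp
  then have "\<forall>\<^sub>F n in sequentially. s n \<in> ball z d"
    using \<open>0 < d\<close> by (intro topological_tendstoD) auto
  then show False using s(2) by simp
qed

theorem theorem5:
  fixes C :: "'a::banach set" and Q :: "'b::banach set" and A :: "'a \<Rightarrow> 'b"
    and f :: "'a \<Rightarrow> 'a \<Rightarrow> real" and g :: "'b \<Rightarrow> 'b \<Rightarrow> real"
    and pstar :: "'n::real_normed_vector" and r :: real and M :: "'n set"
    and ft :: "'n \<Rightarrow> 'a \<Rightarrow> 'a \<Rightarrow> real" and gt :: "'n \<Rightarrow> 'b \<Rightarrow> 'b \<Rightarrow> real"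
  assumes "C \<noteq> {}" and "closed C" and "convex C"
    and "Q \<noteq> {}" and "closed Q" and "convex Q"
    and "bounded_linear A"
    and "r > 0" and "M = cball pstar r"
    and "ft pstar = f" and "gt pstar = g"
    and "\<And>x. usc_on (M \<times> UNIV) (\<lambda>(p, z). ft p z x)"
    and "\<And>y. usc_on (M \<times> UNIV) (\<lambda>(p, w). gt p w y)"
  shows "lp_well_posed f g ft gt C Q A M pstar \<longleftrightarrow>
    (\<forall>\<epsilon>>0. approx_solutions ft gt C Q A M pstar \<epsilon> \<noteq> {}) \<and>
    ((\<lambda>\<epsilon>. ediam (approx_solutions ft gt C Q A M pstar \<epsilon>)) \<longlongrightarrow> 0) (at_right 0)"
proof -
  let ?S = "approx_solutions ft gt C Q A M pstar"
  let ?sol = "sep_solutions f g C Q A"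
  let ?e = "\<lambda>n. inverse (real (Suc n))"
  have "pstar \<in> M" using assms(8,9) by simp
  have sol_sub: "?sol \<subseteq> ?S \<epsilon>" if "0 \<le> \<epsilon>" for \<epsilon>
    unfolding assms(10,11)[symmetric] using \<open>pstar \<in> M\<close> that
    by (rule sep_solutions_subset_approx_solutions)
  have diam_iff: "((\<lambda>\<epsilon>. ediam (?S \<epsilon>)) \<longlongrightarrow> 0) (at_right 0) \<longleftrightarrow>
      (\<forall>d>0. \<exists>\<epsilon>>0. \<forall>u\<in>?S \<epsilon>. \<forall>v\<in>?S \<epsilon>. norm (u - v) \<le> d)"
    by (intro ediam_tendsto_0_iff approx_solutions_mono)
  show ?thesis
    unfolding diam_iff
  proof (intro iffI conjI)
    assume wp: "lp_well_posed f g ft gt C Q A M pstar"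
    then obtain z where z: "?sol = {z}"
      unfolding lp_well_posed_def by blast
    show "\<forall>\<epsilon>>0. ?S \<epsilon> \<noteq> {}"
    proof (intro allI impI)
      fix \<epsilon> :: real assume "\<epsilon> > 0"
      then show "?S \<epsilon> \<noteq> {}" using sol_sub[of \<epsilon>] z by auto
    qed
    show "\<forall>d>0. \<exists>\<epsilon>>0. \<forall>u\<in>?S \<epsilon>. \<forall>v\<in>?S \<epsilon>. norm (u - v) \<le> d"
    proof (intro allI impI)
      fix d :: real assume "d > 0"
      then obtain \<epsilon> where "\<epsilon> > 0" and \<epsilon>: "?S \<epsilon> \<subseteq> ball z (d/2)"
        using lp_well_posed_approx_solutions_near[OF wp, of z "d/2"] z by auto
      have "norm (u - v) \<le> d" if "u \<in> ?S \<epsilon>" "v \<in> ?S \<epsilon>" for u v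
      proof -
        have "dist z u < d/2" "dist z v < d/2" using \<epsilon> that by auto
        then have "dist u v < d" by (rule dist_triangle_half_r)
        then show ?thesis by (simp add: dist_norm)
      qed
      then show "\<exists>\<epsilon>>0. \<forall>u\<in>?S \<epsilon>. \<forall>v\<in>?S \<epsilon>. norm (u - v) \<le> d"
        using \<open>\<epsilon> > 0\<close> by blast
    qed
  next
    assume "(\<forall>\<epsilon>>0. ?S \<epsilon> \<noteq> {}) \<and> (\<forall>d>0. \<exists>\<epsilon>>0. \<forall>u\<in>?S \<epsilon>. \<forall>v\<in>?S \<epsilon>. norm (u - v) \<le> d)"
    then have nonempty: "\<And>\<epsilon>. \<epsilon> > 0 \<Longrightarrow> ?S \<epsilon> \<noteq> {}"
      and small: "\<And>d. d > 0 \<Longrightarrow> \<exists>\<epsilon>>0. \<forall>u\<in>?S \<epsilon>. \<forall>v\<in>?S \<epsilon>. norm (u - v) \<le> d"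
      by auto
    \<comment> \<open>By monotonicity, control at one tolerance covers every
      \<open>\<delta> n\<close> below it; \<open>d/2\<close> makes the bound strict. This serves for
      existence, uniqueness and convergence alike.\<close>
    have close: "\<forall>\<^sub>F n in sequentially. \<forall>u\<in>?S (\<delta> n). \<forall>v\<in>?S (\<delta> n). dist u v < d"
      if lim: "\<delta> \<longlonglongrightarrow> 0" and d: "d > 0" for \<delta> :: "nat \<Rightarrow> real" and d
    proof -
      obtain \<epsilon> where "\<epsilon> > 0" and \<epsilon>: "\<And>u v. u \<in> ?S \<epsilon> \<Longrightarrow> v \<in> ?S \<epsilon> \<Longrightarrow> norm (u - v) \<le> d/2"
        using small[of "d/2"] d by auto
      have "\<forall>\<^sub>F n in sequentially. \<delta> n < \<epsilon>"
        using lim \<open>\<epsilon> > 0\<close> by (rule order_tendstoD)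
      then show ?thesis
      proof (rule eventually_mono, intro ballI)
        fix n u v assume "\<delta> n < \<epsilon>" "u \<in> ?S (\<delta> n)" "v \<in> ?S (\<delta> n)"
        then have "u \<in> ?S \<epsilon>" "v \<in> ?S \<epsilon>"
          by (auto elim!: subsetD[OF approx_solutions_mono[OF less_imp_le]])
        from \<epsilon>[OF this] show "dist u v < d"
          using d by (simp add: dist_norm)
      qed
    qed
    have "\<exists>u. u \<in> ?S (?e n)" for n
      using nonempty[of "?e n"] by auto
    then obtain s where s: "\<And>n. s n \<in> ?S (?e n)"
      by metis
    have "Cauchy s"
    proof (rule metric_CauchyI)
      fix d :: real assume "d > 0"
      then obtain k where k: "\<forall>u\<in>?S (?e k). \<forall>v\<in>?S (?e k). dist u v < d"
        using close[OF LIMSEQ_inverse_real_of_nat] unfolding eventually_sequentially by blast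
      \<comment> \<open>The sets are nested, so the whole tail of \<open>s\<close> from
        \<open>k\<close> on lies in a single set of small diameter.\<close>
      have "s n \<in> ?S (?e k)" if "k \<le> n" for n
      proof -
        have "?e n \<le> ?e k" using that by (intro le_imp_inverse_le) auto
        from approx_solutions_mono[OF this] s[of n] show ?thesis by (rule subsetD)
      qed
      then show "\<exists>k. \<forall>m\<ge>k. \<forall>n\<ge>k. dist (s m) (s n) < d"
        using k by blast
    qed
    \<comment> \<open>Completeness of the product of the two Banach spaces enters here.\<close>
    then obtain z where "s \<longlonglongrightarrow> z"
      by (auto simp: Cauchy_convergent_iff convergent_def)
    obtain p where "\<And>n. p n \<in> M" "p \<longlonglongrightarrow> pstar"
      "gen_approx_seq ft gt C Q A p (\<lambda>n. fst (s n)) (\<lambda>n. snd (s n))"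
      using approx_solutions_sequence[OF s _ LIMSEQ_inverse_real_of_nat] by auto
    then have z: "z \<in> ?sol"
      using gen_approx_seq_limit_mem_sep_solutions[of ft gt C Q A p "\<lambda>n. fst (s n)" "\<lambda>n. snd (s n)"
          M pstar "fst z" "snd z"] \<open>pstar \<in> M\<close> \<open>s \<longlonglongrightarrow> z\<close> assms
      by (simp add: tendsto_fst tendsto_snd)
    \<comment> \<open>Two distinct solutions would lie in every approximate solution set, including
      one whose points are closer together than \<open>dist z' z\<close>.\<close>
    have "z' = z" if "z' \<in> ?sol" for z'
    proof (rule ccontr)
      assume "z' \<noteq> z"
      then obtain n where "\<forall>u\<in>?S (?e n). \<forall>v\<in>?S (?e n). dist u v < dist z' z"
        using close[OF LIMSEQ_inverse_real_of_nat, of "dist z' z"]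
        unfolding eventually_sequentially by auto
      moreover have "z' \<in> ?S (?e n)" "z \<in> ?S (?e n)"
        using that z sol_sub[of "?e n"] by auto
      ultimately show False by blast
    qed
    with z have "?sol = {z}" by blast
    moreover have "(\<lambda>n. (x n, y n)) \<longlonglongrightarrow> z"
      if p: "\<forall>n. p n \<in> M" "p \<longlonglongrightarrow> pstar" and seq: "gen_approx_seq ft gt C Q A p x y" for p x y
    proof -
      obtain \<delta> where \<delta>: "\<delta> \<longlonglongrightarrow> 0" "\<And>n. (x n, y n) \<in> ?S (\<delta> n)"
        using gen_approx_seq_in_approx_solutions[OF seq _ p(2)] p(1) by blast
      have "z \<in> ?S (\<delta> n)" for n
      proof -
        \<comment> \<open>The sign of \<open>\<delta> n\<close>, required by \<open>sol_sub\<close>,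
          is read off from the fact that it bounds a distance.\<close>
        have "0 \<le> \<delta> n"
          using \<delta>(2)[of n] infdist_nonneg[of "x n" C] unfolding approx_solutions_def by auto
        then show ?thesis using z sol_sub by blast
      qed
      \<comment> \<open>Both \<open>z\<close> and \<open>(x n, y n)\<close> lie in the set with
        tolerance \<open>\<delta> n\<close>, so \<open>close\<close> bounds their distance.\<close>
      with \<delta>(2) show ?thesis
        by (intro tendstoI eventually_mono[OF close[OF \<delta>(1)]]) auto
    qed
    ultimately show "lp_well_posed f g ft gt C Q A M pstar"
      unfolding lp_well_posed_def by blast
  qed
qed

end
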